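(* Fix $\sigma>0$. Let $\ell,m$ range over integers with $0\le m\le \ell$ and $m\equiv \ell \pmod 2$. If $\ell-m\to\infty$, then $$d_{\ell,m}(\sigma)\sim \frac{2\sigma}{\pi}\,\frac{2\ell+1}{\sqrt{\ell^2-m^2}},$$ i.e. the ratio of the two sides tends to $1$ as $\ell-m\to\infty$.
   Context: For integer $m\ge 0$ define $$S_m(\nu)=2\tan\left(\frac{\pi(m+\nu)}{2}\right)\frac{\Gamma\left(\frac{\nu+m}{2}+1\right)\Gamma\left(\frac{\nu-m}{2}+1\right)}{\Gamma\left(\frac{\nu+m+1}{2}\right)\Gamma\left(\frac{\nu-m+1}{2}\right)}.$$ For $\sigma>0$ and integers $0\le m\le \ell$ with $m\equiv\ell\pmod 2$, $\nu_{\ell,m}(\sigma)$ denotes the unique solution $\nu$ of $S_m(\nu)=\sigma$ in the open interval $(\ell,\ell+1)$. Put $\Lambda_{\ell,m}(\sigma)=\nu_{\ell,m}(\sigma)(\nu_{\ell,m}(\sigma)+1)$ (these are the Robin eigenvalues of the hemisphere with Robin parameter $\sigma$) and $d_{\ell,m}(\sigma)=\Lambda_{\ell,m}(\sigma)-\ell(\ell+1)$ (the Robin-Neumann gaps). *)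

theory Defs
  imports "HOL-Analysis.Analysis"
begin

definition robin_S :: "nat \<Rightarrow> real \<Rightarrow> real" where
  "robin_S m \<nu> = 2 * tan (pi * (real m + \<nu>) / 2) *
     (Gamma ((\<nu> + real m) / 2 + 1) * Gamma ((\<nu> - real m) / 2 + 1)) /
     (Gamma ((\<nu> + real m + 1) / 2) * Gamma ((\<nu> - real m + 1) / 2))"

(* The description denotes only for \<sigma> > 0, m \<le> l and m \<equiv> l (mod 2): there robin_S m
   increases strictly from 0 to infinity on (l, l + 1). *)
definition robin_nu :: "real \<Rightarrow> nat \<Rightarrow> nat \<Rightarrow> real" where
  "robin_nu \<sigma> l m = (THE \<nu>. \<nu> \<in> {real l <..< real l + 1} \<and> robin_S m \<nu> = \<sigma>)"

definition robin_eigenvalue :: "real \<Rightarrow> nat \<Rightarrow> nat \<Rightarrow> real" where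
  "robin_eigenvalue \<sigma> l m = robin_nu \<sigma> l m * (robin_nu \<sigma> l m + 1)"

definition robin_neumann_gap :: "real \<Rightarrow> nat \<Rightarrow> nat \<Rightarrow> real" where
  "robin_neumann_gap \<sigma> l m = robin_eigenvalue \<sigma> l m - real l * (real l + 1)"

(* Eventually along this filter: for all admissible (l, m) with l - m large, uniformly in l and m.
   Natural subtraction does not truncate on the admissible pairs. *)
definition admissible_at_top :: "(nat \<times> nat) filter" where
  "admissible_at_top = inf (filtercomap (\<lambda>(l, m). l - m) at_top)
     (principal {(l, m). m \<le> l \<and> m mod 2 = l mod 2})"

end

theory Submission
  imports Defs "HOL-Real_Asymp.Real_Asymp"
begin

text \<open>
  Write \<open>\<nu> = l + \<delta>\<close> with \<open>0 < \<delta> < 1\<close> and \<open>H(x) = \<Gamma>(x + 1) / \<Gamma>(x + 1/2)\<close>. Since \<open>l + m\<close> is even,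
  the periodicity of the tangent turns the Robin equation into
  \<open>2 tan(\<pi>\<delta>/2) H((l + m + \<delta>)/2) H((l - m + \<delta>)/2) = \<sigma>\<close>. Both the tangent and \<open>H\<close> increase,
  so the root \<open>\<delta>\<close> exists and is unique (\<open>robin_nu_obtain\<close>).

  The size of \<open>H\<close> follows from its monotonicity and from the telescoping identity
  \<open>H(x) H(x + 1/2) = x + 1/2\<close>: comparing \<open>H(x)\<^sup>2\<close> with the products of neighbours gives
  \<open>x \<le> H(x)\<^sup>2 \<le> x + 1/2\<close>. Consequently twice the product of the two values of \<open>H\<close> above equals
  \<open>sqrt (l\<^sup>2 - m\<^sup>2)\<close> up to a factor between \<open>1\<close> and \<open>1 + 2/(l - m)\<close> (\<open>robin_factor_bounds\<close>). Hence
  \<open>tan(\<pi>\<delta>/2)\<close> is at most \<open>\<sigma>/(l - m)\<close>, the tangent may be replaced by its argument, and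
  \<open>\<delta>\<close> is asymptotic to \<open>(2\<sigma>/\<pi>) / sqrt (l\<^sup>2 - m\<^sup>2)\<close>. The gap is \<open>\<delta> (2 l + 1 + \<delta>)\<close>, in which the
  last \<open>\<delta>\<close> is negligible. All errors are bounded in terms of \<open>l - m\<close> alone
  (\<open>gap_ratio_bounds\<close>), which is what makes the limit uniform in \<open>l\<close> and \<open>m\<close>.
\<close>

section \<open>A quotient of Gamma functions\<close>

definition Gamma_half_ratio :: "real \<Rightarrow> real" where
  "Gamma_half_ratio x = Gamma (x + 1) / Gamma (x + 1/2)"

lemma Gamma_half_ratio_pos: "x > -1/2 \<Longrightarrow> Gamma_half_ratio x > 0"
  by (simp add: Gamma_half_ratio_def)

text \<open>The logarithmic derivative is a difference of two values of the digamma function, which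
  increases on the positive half-line.\<close>

lemma Gamma_half_ratio_mono:
  assumes "-1/2 < x" "x \<le> y"
  shows "Gamma_half_ratio x \<le> Gamma_half_ratio y"
proof -
  have eq: "Gamma_half_ratio z = exp (ln_Gamma (z + 1) - ln_Gamma (z + 1/2))" if "z > -1/2" for z
    using that by (simp add: Gamma_half_ratio_def exp_diff Gamma_real_pos_exp)
  have "ln_Gamma (x + 1) - ln_Gamma (x + 1/2) \<le> ln_Gamma (y + 1) - ln_Gamma (y + 1/2)"
  proof (rule DERIV_nonneg_imp_nondecreasing[OF assms(2)])
    fix z assume "x \<le> z" "z \<le> y"
    then have z: "z > -1/2"
      using assms by simp
    have "((\<lambda>z. ln_Gamma (z + 1) - ln_Gamma (z + 1/2)) has_real_derivative
        Digamma (z + 1) - Digamma (z + 1/2)) (at z)"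
      using z by (auto intro!: derivative_eq_intros)
    moreover have "Digamma (z + 1) - Digamma (z + 1/2) \<ge> 0"
      using z by (simp add: Digamma_real_mono)
    ultimately show "\<exists>d. ((\<lambda>z. ln_Gamma (z + 1) - ln_Gamma (z + 1/2)) has_real_derivative d) (at z)
        \<and> 0 \<le> d"
      by blast
  qed
  then show ?thesis
    using assms by (simp add: eq)
qed

text \<open>The two quotients share the value \<open>\<Gamma>(x + 1)\<close>, so their product telescopes to
  \<open>\<Gamma>(x + 3/2) / \<Gamma>(x + 1/2)\<close>.\<close>

lemma Gamma_half_ratio_mult_shift:
  assumes "x > -1/2"
  shows "Gamma_half_ratio x * Gamma_half_ratio (x + 1/2) = x + 1/2"
proof -
  have step: "Gamma (x + 1/2 + 1) = (x + 1/2) * Gamma (x + 1/2)"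
    by (rule Gamma_plus1) (use assms in \<open>auto elim!: nonpos_Ints_cases\<close>)
  have half: "x + 1/2 + 1/2 = x + 1"
    by simp
  have cancel: "a / g * (c * g / a) = c" if "a > 0" "g > 0" for a g c :: real
    using that by simp
  show ?thesis
    unfolding Gamma_half_ratio_def step half using assms by (intro cancel Gamma_real_pos) auto
qed

text \<open>This bound and the next: since the quotient increases, its square lies between its products
  with the values half a unit to the left and to the right, which the telescoping identity
  evaluates.\<close>

lemma Gamma_half_ratio_square_le:
  assumes "x > -1/2"
  shows "(Gamma_half_ratio x)\<^sup>2 \<le> x + 1/2"
proof -
  have "(Gamma_half_ratio x)\<^sup>2 \<le> Gamma_half_ratio x * Gamma_half_ratio (x + 1/2)"
    unfolding power2_eq_square
    using assms Gamma_half_ratio_pos[OF assms]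
    by (intro mult_left_mono Gamma_half_ratio_mono) auto
  then show ?thesis
    using Gamma_half_ratio_mult_shift[OF assms] by simp
qed

lemma Gamma_half_ratio_square_ge:
  assumes "x > 0"
  shows "x \<le> (Gamma_half_ratio x)\<^sup>2"
proof -
  have "Gamma_half_ratio (x - 1/2) * Gamma_half_ratio x \<le> (Gamma_half_ratio x)\<^sup>2"
    unfolding power2_eq_square
    using assms Gamma_half_ratio_pos[of x]
    by (intro mult_right_mono Gamma_half_ratio_mono) auto
  then show ?thesis
    using Gamma_half_ratio_mult_shift[of "x - 1/2"] assms by simp
qed

lemma continuous_on_Gamma_half_ratio [continuous_intros]:
  assumes "continuous_on A f" "\<And>x. x \<in> A \<Longrightarrow> f x > -1/2"
  shows "continuous_on A (\<lambda>x. Gamma_half_ratio (f x))"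
proof -
  have "isCont Gamma_half_ratio y" if "y > -1/2" for y
  proof -
    have "y + 1/2 \<notin> \<int>\<^sub>\<le>\<^sub>0" "y + 1 \<notin> \<int>\<^sub>\<le>\<^sub>0"
      using that by (auto elim!: nonpos_Ints_cases)
    moreover from this have "Gamma (y + 1/2) \<noteq> 0"
      by (simp add: Gamma_eq_zero_iff)
    ultimately show ?thesis
      unfolding Gamma_half_ratio_def by (intro continuous_intros) auto
  qed
  then have "continuous_on {-1/2<..} Gamma_half_ratio"
    by (simp add: continuous_at_imp_continuous_on)
  then show ?thesis
    by (rule continuous_on_compose2) (use assms in auto)
qed

section \<open>The Robin equation on the interval from \<open>l\<close> to \<open>l + 1\<close>\<close>

text \<open>Half of what remains of \<open>robin_S m (l + \<delta>)\<close> once the tangent is split off.\<close>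

definition robin_factor :: "nat \<Rightarrow> nat \<Rightarrow> real \<Rightarrow> real" where
  "robin_factor l m \<delta> =
     Gamma_half_ratio ((real l + real m + \<delta>) / 2) * Gamma_half_ratio ((real l - real m + \<delta>) / 2)"

lemma robin_S_eq_tan_mult_factor:
  assumes "m mod 2 = l mod 2"
  shows "robin_S m (real l + \<delta>) = 2 * tan (pi * \<delta> / 2) * robin_factor l m \<delta>"
proof -
  from assms have "even (l + m)"
    by presburger
  then obtain k where "l + m = 2 * k"
    by (elim evenE)
  then have k: "real l + real m = 2 * real k"
    by linarith
  have "real m + (real l + \<delta>) = 2 * real k + \<delta>"
    using k by simp
  then have shift: "pi * (real m + (real l + \<delta>)) / 2 = pi * \<delta> / 2 + real k * pi"
    by (simp only:) (simp add: field_simps)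
  have "tan (pi * (real m + (real l + \<delta>)) / 2) = tan (pi * \<delta> / 2)"
    unfolding shift by (rule tan_periodic_nat)
  then show ?thesis
    by (simp add: robin_S_def robin_factor_def Gamma_half_ratio_def add_divide_distrib
        diff_divide_distrib algebra_simps)
qed

lemma robin_factor_pos:
  assumes "m \<le> l" "\<delta> \<ge> 0"
  shows "robin_factor l m \<delta> > 0"
  using assms by (auto simp: robin_factor_def intro!: mult_pos_pos Gamma_half_ratio_pos)

lemma robin_factor_mono:
  assumes "m \<le> l" "0 \<le> \<delta>" "\<delta> \<le> \<epsilon>"
  shows "robin_factor l m \<delta> \<le> robin_factor l m \<epsilon>"
  unfolding robin_factor_def using assms
  by (intro mult_mono Gamma_half_ratio_mono less_imp_le[OF Gamma_half_ratio_pos])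
     (auto simp: field_simps)

text \<open>With \<open>p = l + m\<close> and \<open>n = l - m\<close>, the square of twice the factor lies between
  \<open>p n\<close> and \<open>(p + 2) (n + 2)\<close>. As \<open>n \<le> p\<close>, the relative error \<open>2/p\<close> is at most \<open>2/n\<close>, so the error
  relative to \<open>sqrt (p n)\<close> is controlled by \<open>n\<close> alone.\<close>

lemma robin_factor_bounds:
  assumes "m < l" "0 \<le> \<delta>" "\<delta> \<le> 1"
  shows "sqrt ((real l)\<^sup>2 - (real m)\<^sup>2) \<le> 2 * robin_factor l m \<delta>"
    and "2 * robin_factor l m \<delta> \<le>
      (1 + 2 / (real l - real m)) * sqrt ((real l)\<^sup>2 - (real m)\<^sup>2)"
proof -
  define p n where "p = real l + real m" and "n = real l - real m"
  let ?a = "(p + \<delta>) / 2" and ?b = "(n + \<delta>) / 2"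
  have n: "0 < n" "n \<le> p"
    using assms by (simp_all add: n_def p_def)
  have pn: "(real l)\<^sup>2 - (real m)\<^sup>2 = p * n"
    by (simp add: p_def n_def power2_eq_square algebra_simps)
  have fac: "(2 * robin_factor l m \<delta>)\<^sup>2 = 4 * ((Gamma_half_ratio ?a)\<^sup>2 * (Gamma_half_ratio ?b)\<^sup>2)"
    by (simp add: robin_factor_def p_def n_def power_mult_distrib)
  have pos: "robin_factor l m \<delta> > 0"
    using robin_factor_pos assms by simp
  have "p * n \<le> 4 * (?a * ?b)"
    using n assms by (simp add: mult_mono)
  also have "\<dots> \<le> (2 * robin_factor l m \<delta>)\<^sup>2"
    unfolding fac using n assms
    by (intro mult_left_mono mult_mono Gamma_half_ratio_square_ge) auto
  finally show "sqrt ((real l)\<^sup>2 - (real m)\<^sup>2) \<le> 2 * robin_factor l m \<delta>"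
    unfolding pn using pos by (simp add: real_le_lsqrt)
  have "(2 * robin_factor l m \<delta>)\<^sup>2 \<le> 4 * ((?a + 1/2) * (?b + 1/2))"
    unfolding fac using n assms
    by (intro mult_left_mono mult_mono Gamma_half_ratio_square_le) auto
  also have "\<dots> \<le> 4 * ((p/2 + 1) * (n/2 + 1))"
    using n assms by (intro mult_left_mono mult_mono) (auto simp: field_simps)
  also have "\<dots> = (1 + 2/p) * (1 + 2/n) * (p * n)"
    using n by (simp add: field_simps)
  also have "\<dots> \<le> (1 + 2/n) * (1 + 2/n) * (p * n)"
    using n by (intro mult_right_mono) (auto simp: frac_le)
  also have "\<dots> = ((1 + 2/n) * sqrt (p * n))\<^sup>2"
    using n by (simp add: power_mult_distrib power2_eq_square)
  finally show "2 * robin_factor l m \<delta> \<le>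
      (1 + 2 / (real l - real m)) * sqrt ((real l)\<^sup>2 - (real m)\<^sup>2)"
    unfolding pn n_def[symmetric] by (rule power2_le_imp_le) (use n in auto)
qed

text \<open>This replaces the definite description by a usable equation. Existence is the intermediate
  value theorem on a closed subinterval that stays away from the pole of the tangent at \<open>\<delta> = 1\<close>;
  uniqueness is strict monotonicity.\<close>

lemma robin_nu_obtain:
  assumes "\<sigma> > 0" "m \<le> l" "m mod 2 = l mod 2"
  obtains \<delta> where "0 < \<delta>" "\<delta> < 1" "robin_nu \<sigma> l m = real l + \<delta>"
    "2 * tan (pi * \<delta> / 2) * robin_factor l m \<delta> = \<sigma>"
proof -
  define f where "f = (\<lambda>\<delta>. 2 * tan (pi * \<delta> / 2) * robin_factor l m \<delta>)"
  have f_strict: "f x < f y" if "0 < x" "x < y" "y < 1" for x y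
  proof -
    have "tan (pi * x / 2) < tan (pi * y / 2)" "0 < tan (pi * x / 2)"
      using that by (auto intro!: tan_monotone tan_gt_zero simp: less_le_trans[of _ 0])
    then show ?thesis
      unfolding f_def using that assms
      by (intro mult_less_le_imp_less[of "2 * tan _"] robin_factor_mono robin_factor_pos) simp_all
  qed
  \<comment> \<open>At \<open>b\<close> the equation would hold exactly if the factor kept its value at \<open>0\<close>; as the factor
      increases, \<open>f b\<close> is at least \<open>\<sigma>\<close>.\<close>
  define b where "b = 2 / pi * arctan (\<sigma> / (2 * robin_factor l m 0))"
  have F0: "robin_factor l m 0 > 0"
    using robin_factor_pos assms by simp
  have b: "0 < b" "b < 1"
    using assms F0 arctan_ubound[of "\<sigma> / (2 * robin_factor l m 0)"]
    by (auto simp: b_def field_simps)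
  have "\<sigma> = 2 * tan (pi * b / 2) * robin_factor l m 0"
    using F0 by (simp add: b_def tan_arctan)
  also have "\<dots> \<le> f b"
    unfolding f_def using assms b
    by (intro mult_left_mono robin_factor_mono) (auto intro!: tan_pos_pi2_le simp: less_le_trans[of _ 0])
  finally have fb: "\<sigma> \<le> f b" .
  have cos: "cos (pi * x / 2) \<noteq> 0" if "x \<in> {0..b}" for x
  proof -
    have "pi * x / 2 < pi / 2" "- (pi / 2) < pi * x / 2"
      using that b by (auto simp: less_le_trans[of _ 0])
    then show ?thesis
      using cos_gt_zero_pi by fastforce
  qed
  have "continuous_on {0..b} f"
    unfolding f_def robin_factor_def using assms cos
    by (intro continuous_intros ballI) auto
  then obtain \<delta> where \<delta>: "0 \<le> \<delta>" "\<delta> \<le> b" "f \<delta> = \<sigma>"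
    using IVT'[of f 0 \<sigma> b] fb b assms by (auto simp: f_def)
  have "\<delta> \<noteq> 0"
    using \<delta>(3) assms by (auto simp: f_def)
  then have \<delta>1: "0 < \<delta>" "\<delta> < 1"
    using \<delta> b by auto
  have "robin_nu \<sigma> l m = real l + \<delta>"
    unfolding robin_nu_def
  proof (rule the_equality)
    show "real l + \<delta> \<in> {real l<..<real l + 1} \<and> robin_S m (real l + \<delta>) = \<sigma>"
      using \<delta>1 \<delta>(3) robin_S_eq_tan_mult_factor[OF assms(3)] by (simp add: f_def)
  next
    fix \<nu> assume \<nu>: "\<nu> \<in> {real l<..<real l + 1} \<and> robin_S m \<nu> = \<sigma>"
    then have "f (\<nu> - real l) = f \<delta>"
      using \<delta>(3) robin_S_eq_tan_mult_factor[OF assms(3), of "\<nu> - real l"] by (simp add: f_def)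
    then show "\<nu> = real l + \<delta>"
      using f_strict[of "\<nu> - real l" \<delta>] f_strict[of \<delta> "\<nu> - real l"] \<nu> \<delta>1 by force
  qed
  then show ?thesis
    using that \<delta>1 \<delta>(3) by (simp add: f_def)
qed

section \<open>The gap asymptotics\<close>

text \<open>The lower bound is \<open>sin x cos x \<le> x\<close> at \<open>x = arctan t\<close>.\<close>

lemma arctan_bounds:
  assumes "(t::real) \<ge> 0"
  shows "t / (1 + t\<^sup>2) \<le> arctan t" and "arctan t \<le> t"
proof -
  have x: "arctan t \<ge> 0"
    using assms by simp
  have sq: "sqrt (1 + t\<^sup>2) * sqrt (1 + t\<^sup>2) = 1 + t\<^sup>2"
    by simp
  have "t / (1 + t\<^sup>2) = sin (arctan t) * cos (arctan t)"
    unfolding sin_arctan cos_arctan times_divide_times_eq sq by simp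
  also have "\<dots> \<le> sin (arctan t)"
    using assms by (intro mult_left_le) (simp_all add: sin_arctan)
  also have "\<dots> \<le> arctan t"
    by (rule sin_x_le_x[OF x])
  finally show "t / (1 + t\<^sup>2) \<le> arctan t" .
  have "0 - arctan 0 \<le> t - arctan t"
  proof (rule DERIV_nonneg_imp_nondecreasing[OF assms])
    fix x :: real
    have "((\<lambda>x. x - arctan x) has_real_derivative 1 - inverse (1 + x\<^sup>2)) (at x)"
      by (auto intro!: derivative_eq_intros)
    moreover have "1 - inverse (1 + x\<^sup>2) \<ge> 0"
      by (simp add: inverse_le_1_iff)
    ultimately show "\<exists>d. ((\<lambda>x. x - arctan x) has_real_derivative d) (at x) \<and> 0 \<le> d"
      by blast
  qed
  then show "arctan t \<le> t"
    by simp
qed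

text \<open>With \<open>t = tan (\<pi>\<delta>/2)\<close>, the ratio of the gap to its claimed asymptotic value is a product of
  three errors, each close to \<open>1\<close>: \<open>arctan t / t\<close> from linearising the tangent, \<open>q\<close> from replacing
  the Gamma quotients by a square root, and \<open>1 + e\<close> from the quadratic term \<open>\<delta>\<^sup>2\<close> of the gap.\<close>

lemma gap_ratio_bounds:
  fixes \<sigma> :: real and l m :: nat
  defines "N \<equiv> real l - real m"
    and "R \<equiv> robin_neumann_gap \<sigma> l m /
            (2 * \<sigma> / pi * ((2 * real l + 1) / sqrt ((real l)\<^sup>2 - (real m)\<^sup>2)))"
  assumes \<sigma>: "\<sigma> > 0" and ml: "m < l" "m mod 2 = l mod 2"
  shows "1 / (1 + (\<sigma> / N)\<^sup>2) * (1 / (1 + 2 / N)) \<le> R"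
    and "R \<le> 1 + \<sigma> / N"
proof -
  obtain \<delta> where \<delta>: "0 < \<delta>" "\<delta> < 1" "robin_nu \<sigma> l m = real l + \<delta>"
    "2 * tan (pi * \<delta> / 2) * robin_factor l m \<delta> = \<sigma>"
    using robin_nu_obtain[OF \<sigma> _ ml(2)] ml(1) by (metis less_imp_le)
  define s where "s = sqrt ((real l)\<^sup>2 - (real m)\<^sup>2)"
  define P where "P = robin_factor l m \<delta>"
  define t where "t = tan (pi * \<delta> / 2)"
  define q where "q = s / (2 * P)"
  define e where "e = \<delta> / (2 * real l + 1)"
  have N: "N > 0"
    using ml by (simp add: N_def)
  have P: "P > 0"
    using robin_factor_pos \<delta> ml by (simp add: P_def)
  have "N\<^sup>2 \<le> (real l)\<^sup>2 - (real m)\<^sup>2"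
    using ml mult_mono[of "real m" "real l" "real m" "real m"]
    by (simp add: N_def power2_eq_square algebra_simps)
  then have s: "N \<le> s"
    unfolding s_def by (rule real_le_rsqrt)
  have sP: "s \<le> 2 * P" "2 * P \<le> (1 + 2 / N) * s"
    using robin_factor_bounds[OF ml(1), of \<delta>] \<delta> by (simp_all add: s_def P_def N_def)
  have t: "t = \<sigma> / (2 * P)"
    using \<delta>(4) P by (simp add: t_def P_def field_simps)
  have t_bounds: "0 < t" "t \<le> \<sigma> / N"
    using P \<sigma> s sP N unfolding t by (auto intro!: divide_left_mono mult_pos_pos)
  have "- (pi / 2) < pi * \<delta> / 2" "pi * \<delta> / 2 < pi / 2"
    using \<delta> by (auto simp: less_le_trans[of _ 0])
  then have \<delta>_eq: "\<delta> = 2 / pi * arctan t"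
    by (simp add: t_def arctan_tan)
  have q: "1 / (1 + 2 / N) \<le> q" "q \<le> 1"
    using sP P N by (auto simp: q_def field_simps)
  have "\<delta> \<le> arctan t"
    using t_bounds pi_ge_two unfolding \<delta>_eq by (intro mult_left_le_one_le) auto
  also have "\<dots> \<le> \<sigma> / N"
    using arctan_bounds(2)[of t] t_bounds by simp
  finally have "\<delta> \<le> \<sigma> / N" .
  moreover have "e \<le> \<delta>" "0 \<le> e"
    using \<delta> by (auto simp: e_def divide_le_eq mult_le_cancel_left1)
  ultimately have e: "0 \<le> e" "e \<le> \<sigma> / N"
    by auto
  have gap: "robin_neumann_gap \<sigma> l m = \<delta> * (1 + e) * (2 * real l + 1)"
    by (simp add: robin_neumann_gap_def robin_eigenvalue_def \<delta>(3) e_def field_simps)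
  have "R = \<delta> * (1 + e) * (2 * real l + 1) / (2 * \<sigma> / pi * ((2 * real l + 1) / s))"
    unfolding R_def gap s_def ..
  also have "\<dots> = \<delta> * (1 + e) * (pi * s / (2 * \<sigma>))"
  proof -
    have "x * L / (2 * \<sigma> / pi * (L / s)) = x * (pi * s / (2 * \<sigma>))" if "L > 0" for x L
      using that \<sigma> s N by (simp add: field_simps)
    then show ?thesis
      by simp
  qed
  also have "\<dots> = arctan t * (1 + e) * (s / \<sigma>)"
    unfolding \<delta>_eq by simp
  also have "\<dots> = arctan t / t * q * (1 + e)"
    using P \<sigma> unfolding q_def t by (simp add: field_simps)
  finally have R: "R = arctan t / t * q * (1 + e)" .
  have arctan_quot: "1 / (1 + (\<sigma> / N)\<^sup>2) \<le> arctan t / t" "arctan t / t \<le> 1"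
  proof -
    have "1 / (1 + (\<sigma> / N)\<^sup>2) \<le> 1 / (1 + t\<^sup>2)"
      using t_bounds by (intro divide_left_mono add_left_mono power_mono mult_pos_pos add_pos_nonneg) auto
    also have "\<dots> \<le> arctan t / t"
      using arctan_bounds(1)[of t] t_bounds by (simp add: field_simps)
    finally show "1 / (1 + (\<sigma> / N)\<^sup>2) \<le> arctan t / t" .
    show "arctan t / t \<le> 1"
      using arctan_bounds(2)[of t] t_bounds by simp
  qed
  have q0: "0 \<le> q" and arctan_quot0: "0 \<le> arctan t / t"
    using P s N t_bounds by (auto simp: q_def)
  have "1 / (1 + (\<sigma> / N)\<^sup>2) * (1 / (1 + 2 / N)) \<le> arctan t / t * q"
    using arctan_quot q N arctan_quot0 by (intro mult_mono) auto
  also have "\<dots> \<le> arctan t / t * q * (1 + e)"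
    using mult_left_mono[of 1 "1 + e", OF _ mult_nonneg_nonneg[OF arctan_quot0 q0]] e by simp
  finally show "1 / (1 + (\<sigma> / N)\<^sup>2) * (1 / (1 + 2 / N)) \<le> R"
    unfolding R .
  have "arctan t / t * q \<le> 1"
    using arctan_quot q q0 arctan_quot0 by (intro mult_le_one) auto
  then have "arctan t / t * q * (1 + e) \<le> 1 * (1 + \<sigma> / N)"
    using e by (intro mult_mono) auto
  then show "R \<le> 1 + \<sigma> / N"
    unfolding R by simp
qed

theorem proposition1p1:
  fixes \<sigma> :: real
  assumes "\<sigma> > 0"
  shows "((\<lambda>(l, m). robin_neumann_gap \<sigma> l m /
            (2 * \<sigma> / pi * ((2 * real l + 1) / sqrt ((real l)\<^sup>2 - (real m)\<^sup>2))))
          \<longlongrightarrow> 1) admissible_at_top"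
proof -
  let ?N = "\<lambda>(l, m). real (l - m)"
  have lim: "filterlim (\<lambda>(l, m). l - m) at_top admissible_at_top"
    unfolding admissible_at_top_def
    by (rule filterlim_mono[OF filterlim_filtercomap order_refl inf_le1])
  have "filterlim (\<lambda>x. real (case x of (l, m) \<Rightarrow> l - m)) at_top admissible_at_top"
    by (rule filterlim_compose[OF filterlim_real_sequentially lim])
  then have N: "filterlim ?N at_top admissible_at_top"
    by (simp add: case_prod_unfold)
  have adm: "\<forall>\<^sub>F (l, m) in admissible_at_top. m < l \<and> m mod 2 = l mod 2"
  proof -
    have "\<forall>\<^sub>F (l, m) in admissible_at_top. m \<le> l \<and> m mod 2 = l mod 2"
      unfolding admissible_at_top_def eventually_inf_principal by (simp add: case_prod_unfold)
    moreover have "\<forall>\<^sub>F x in admissible_at_top. 0 < (case x of (l, m) \<Rightarrow> l - m)"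
      using lim by (rule eventually_compose_filterlim[OF eventually_gt_at_top])
    ultimately show ?thesis
      by eventually_elim auto
  qed
  have "((\<lambda>N. 1 / (1 + (\<sigma> / N)\<^sup>2) * (1 / (1 + 2 / N))) \<longlongrightarrow> 1) at_top"
    using assms by real_asymp
  from filterlim_compose[OF this N]
  have lower: "((\<lambda>x. 1 / (1 + (\<sigma> / ?N x)\<^sup>2) * (1 / (1 + 2 / ?N x))) \<longlongrightarrow> 1) admissible_at_top" .
  have "((\<lambda>N. 1 + \<sigma> / N) \<longlongrightarrow> 1) at_top"
    using assms by real_asymp
  from filterlim_compose[OF this N]
  have upper: "((\<lambda>x. 1 + \<sigma> / ?N x) \<longlongrightarrow> 1) admissible_at_top" .
  show ?thesis
  proof (rule tendsto_sandwich[OF _ _ lower upper])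
    show "\<forall>\<^sub>F x in admissible_at_top. 1 / (1 + (\<sigma> / ?N x)\<^sup>2) * (1 / (1 + 2 / ?N x)) \<le>
        (case x of (l, m) \<Rightarrow> robin_neumann_gap \<sigma> l m /
          (2 * \<sigma> / pi * ((2 * real l + 1) / sqrt ((real l)\<^sup>2 - (real m)\<^sup>2))))"
      using adm
    proof eventually_elim
      case (elim x)
      then show ?case
        using gap_ratio_bounds(1)[OF assms, of "snd x" "fst x"]
        by (simp add: case_prod_unfold of_nat_diff)
    qed
    show "\<forall>\<^sub>F x in admissible_at_top.
        (case x of (l, m) \<Rightarrow> robin_neumann_gap \<sigma> l m /
          (2 * \<sigma> / pi * ((2 * real l + 1) / sqrt ((real l)\<^sup>2 - (real m)\<^sup>2)))) \<le> 1 + \<sigma> / ?N x"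
      using adm
    proof eventually_elim
      case (elim x)
      then show ?case
        using gap_ratio_bounds(2)[OF assms, of "snd x" "fst x"]
        by (simp add: case_prod_unfold of_nat_diff)
    qed
  qed
qed

end
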